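(* Let $m,n\ge 1$, $\alpha\in\Sigma_m$, $\beta\in\Sigma_n$, let $C\in\mathbb{R}^{m\times m}$ and $D\in\mathbb{R}^{n\times n}$ be symmetric, let $\ell:\mathbb{R}\times\mathbb{R}\to\mathbb{R}$ be smooth, and let $L\in\mathbb{R}^{mn\times mn}$ be the symmetric matrix with $L_{(i,j),(k,l)}=\ell(C_{i,k},D_{j,l})$. Write $a_i=\mathrm{vec}(e_i\mathbf 1_n^\top)$ for $i\in[m]$ and $b_j=\mathrm{vec}(\mathbf 1_m e_j^\top)$ for $j\in[n]$. Consider the problem (GW++): $$\min_{\pi\in\mathbb{R}^{m\times n},\,P\in\mathbb{R}^{mn\times mn}}\ \langle L,P\rangle\quad\text{s.t.}\quad P=\mathrm{vec}(\pi)\mathrm{vec}(\pi)^\top,\ \ \pi\in\Pi(\alpha,\beta),\ \ Pa_i=\alpha_i\,\mathrm{vec}(\pi)\ (i\in[m]),\ \ Pb_j=\beta_j\,\mathrm{vec}(\pi)\ (j\in[n]),\ \ P\ge 0,$$ and the problem (GW-Dual): $$\max\ \ \lambda^\top\alpha+\mu^\top\beta-t$$ $$\text{s.t.}\quad \begin{pmatrix} L-Z+\frac12\sum_{i=1}^m(\eta^i a_i^\top+a_i{\eta^i}^\top)+\frac12\sum_{j=1}^n(\theta^j b_j^\top+b_j{\theta^j}^\top) & y\\ y^\top & t\end{pmatrix}\succeq 0,$$ $$\sum_{i=1}^m(\lambda_i a_i+\alpha_i\eta^i)+\sum_{j=1}^n(\mu_j b_j+\beta_j\theta^j)+2y\le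 0,\qquad Z\ge 0,$$ over $\lambda\in\mathbb{R}^m$, $\mu\in\mathbb{R}^n$, $\eta^i,\theta^j\in\mathbb{R}^{mn}$ ($i\in[m]$, $j\in[n]$), $Z\in\mathbb{R}^{mn\times mn}$ symmetric, $y\in\mathbb{R}^{mn}$, $t\in\mathbb{R}$. Then (GW-Dual) is the Lagrangian dual of (GW++).
   Context: Notation. $\Sigma_m=\{\alpha\in\mathbb{R}^m:\alpha\ge0,\ \sum_i\alpha_i=1\}$; $\mathbf 1_n\in\mathbb{R}^n$ is the all-ones vector; $e_i$ is a standard basis vector; $[m]=\{1,\dots,m\}$. $\Pi(\alpha,\beta)=\{\pi\in\mathbb{R}^{m\times n}:\pi\ge0,\ \pi\mathbf 1_n=\alpha,\ \pi^\top\mathbf 1_m=\beta\}$, so its equality constraints read $a_i^\top\mathrm{vec}(\pi)=\alpha_i$ and $b_j^\top\mathrm{vec}(\pi)=\beta_j$. $\mathrm{vec}(\pi)\in\mathbb{R}^{mn}$ stacks the columns of $\pi$; its coordinates are indexed by pairs $(i,j)$, and $mn\times mn$ matrices are indexed by pairs of such pairs. $\ge$ and $\le$ between vectors or matrices are entrywise; $\succeq0$ means symmetric positive semidefinite; $\langle A,B\rangle=\mathrm{tr}(A^\top B)$. Lagrangian of (GW++). The multipliers are: $Y\in\mathbb{R}^{mn\times mn}$ (symmetric) for $P=\mathrm{vec}(\pi)\mathrm{vec}(\pi)^\top$; $z\in\mathbb{R}^{mn}$, $z\ge0$, for $\mathrm{vec}(\pi)\ge0$; $\lambda_i\in\mathbb{R}$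 for $a_i^\top\mathrm{vec}(\pi)=\alpha_i$; $\mu_j\in\mathbb{R}$ for $b_j^\top\mathrm{vec}(\pi)=\beta_j$; $Z\ge0$ (symmetric) for $P\ge0$; $\eta^i\in\mathbb{R}^{mn}$ for $Pa_i=\alpha_i\mathrm{vec}(\pi)$; $\theta^j\in\mathbb{R}^{mn}$ for $Pb_j=\beta_j\mathrm{vec}(\pi)$. The Lagrangian is $$\mathcal L=\mathrm{tr}(LP)-\mathrm{tr}\big(Y(P-\mathrm{vec}(\pi)\mathrm{vec}(\pi)^\top)\big)+\sum_i\lambda_i(\alpha_i-a_i^\top\mathrm{vec}(\pi))+\sum_j\mu_j(\beta_j-b_j^\top\mathrm{vec}(\pi))+\sum_i{\eta^i}^\top(Pa_i-\alpha_i\mathrm{vec}(\pi))+\sum_j{\theta^j}^\top(Pb_j-\beta_j\mathrm{vec}(\pi))-\mathrm{tr}(ZP)-z^\top\mathrm{vec}(\pi).$$ The dual function is the infimum of $\mathcal L$ over all symmetric $P\in\mathbb{R}^{mn\times mn}$ and all $\pi\in\mathbb{R}^{m\times n}$ (value $-\infty$ allowed), and the Lagrangian dual problem is to maximize it over all multipliers with $Z\ge0$, $z\ge0$. Meaning of "is the Lagrangian dual". Identity of optimization problems is understood after rewriting with the auxiliary variables $y,t$ in place of $Y,z$: for every fixed $(\lambda,\mu,\eta,\theta,Z)$ with $Z\ge0$ symmetric, the supremum of the dual function over symmetric $Y$ and $z\ge0$ equals the supremum of $\lambda^\top\alpha+\mu^\top\beta-t$ over all $(y,t)$ satisfying the constraints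 of (GW-Dual) (with value $-\infty$ if there is none). In particular the two problems have the same optimal value. *)

theory Defs
  imports "HOL-Analysis.Analysis"
begin

text \<open>
  The dimensions m and n are the cardinalities of the index types \<^typ>\<open>'m\<close> and \<^typ>\<open>'n\<close> (finite and
  nonempty). Coordinates of vectors of length mn are indexed by pairs, so the column-stacking order
  of vec plays no role. The order on vectors and matrices is the library's entrywise order, and the
  library's vector \<^term>\<open>1 :: real ^ 'n\<close> is the all-ones vector.
\<close>

text \<open>Class $C^k$ on the whole space: all directional derivatives up to order k exist as Frechet
  derivatives and are continuous.\<close>

primrec C_k :: "nat \<Rightarrow> ('a::real_normed_vector \<Rightarrow> 'b::real_normed_vector) \<Rightarrow> bool" where
  "C_k 0 f \<longleftrightarrow> continuous_on UNIV f"
| "C_k (Suc k) f \<longleftrightarrow>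
     (\<forall>x. f differentiable (at x)) \<and> (\<forall>v. C_k k (\<lambda>x. frechet_derivative f (at x) v))"

definition smooth :: "('a::real_normed_vector \<Rightarrow> 'b::real_normed_vector) \<Rightarrow> bool" where
  "smooth f \<longleftrightarrow> (\<forall>k. C_k k f)"

definition symmetric :: "real ^ 'k ^ 'k \<Rightarrow> bool" where
  "symmetric A \<longleftrightarrow> transpose A = A"

definition psd :: "real ^ 'k ^ 'k \<Rightarrow> bool" where
  "psd A \<longleftrightarrow> symmetric A \<and> (\<forall>x. 0 \<le> x \<bullet> (A *v x))"

definition prob_simplex :: "(real ^ 'k) set" where
  "prob_simplex = {\<alpha>. 0 \<le> \<alpha> \<and> (\<Sum>i\<in>UNIV. \<alpha> $ i) = 1}"

definition couplings :: "real ^ 'm \<Rightarrow> real ^ 'n \<Rightarrow> (real ^ 'n ^ 'm) set" where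
  "couplings \<alpha> \<beta> = {\<pi>. 0 \<le> \<pi> \<and> \<pi> *v 1 = \<alpha> \<and> transpose \<pi> *v 1 = \<beta>}"

definition vectorize :: "real ^ 'n ^ 'm \<Rightarrow> real ^ ('m \<times> 'n)" where
  "vectorize \<pi> = (\<chi> p. \<pi> $ fst p $ snd p)"

text \<open>The matrix $u v^\top$.\<close>

definition outer :: "real ^ 'a \<Rightarrow> real ^ 'b \<Rightarrow> real ^ 'b ^ 'a" where
  "outer u v = (\<chi> i j. u $ i * v $ j)"

definition a_vec :: "'m::finite \<Rightarrow> real ^ ('m \<times> 'n::finite)" where
  "a_vec i = vectorize (outer (axis i 1) 1)"

definition b_vec :: "'n::finite \<Rightarrow> real ^ ('m::finite \<times> 'n)" where
  "b_vec j = vectorize (outer 1 (axis j 1))"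

definition cost_matrix ::
  "(real \<times> real \<Rightarrow> real) \<Rightarrow> real ^ 'm ^ 'm \<Rightarrow> real ^ 'n ^ 'n \<Rightarrow> real ^ ('m \<times> 'n) ^ ('m \<times> 'n)" where
  "cost_matrix l C D = (\<chi> p q. l (C $ fst p $ fst q, D $ snd p $ snd q))"

text \<open>The block matrix with blocks M, y, $y^\top$, t. The additional last row and column carry the
  index \<^term>\<open>Inr ()\<close>.\<close>

definition bordered :: "real ^ 'k ^ 'k \<Rightarrow> real ^ 'k \<Rightarrow> real \<Rightarrow> real ^ ('k + unit) ^ ('k + unit)" where
  "bordered M y t = (\<chi> p q. case p of
       Inl i \<Rightarrow> (case q of Inl j \<Rightarrow> M $ i $ j | Inr _ \<Rightarrow> y $ i)
     | Inr _ \<Rightarrow> (case q of Inl j \<Rightarrow> y $ j | Inr _ \<Rightarrow> t))"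

definition gwpp_objective ::
  "real ^ ('m::finite \<times> 'n::finite) ^ ('m \<times> 'n) \<Rightarrow> real ^ ('m \<times> 'n) ^ ('m \<times> 'n) \<Rightarrow> real" where
  "gwpp_objective L P = trace (transpose L ** P)"

definition gwpp_feasible ::
  "real ^ 'm \<Rightarrow> real ^ 'n \<Rightarrow> real ^ 'n ^ 'm \<Rightarrow> real ^ ('m \<times> 'n) ^ ('m \<times> 'n) \<Rightarrow> bool" where
  "gwpp_feasible \<alpha> \<beta> \<pi> P \<longleftrightarrow>
     P = outer (vectorize \<pi>) (vectorize \<pi>) \<and>
     \<pi> \<in> couplings \<alpha> \<beta> \<and>
     (\<forall>i. P *v a_vec i = (\<alpha> $ i) *\<^sub>R vectorize \<pi>) \<and>
     (\<forall>j. P *v b_vec j = (\<beta> $ j) *\<^sub>R vectorize \<pi>) \<and>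
     0 \<le> P"

definition gwpp_lagrangian ::
  "real ^ 'm \<Rightarrow> real ^ 'n \<Rightarrow> real ^ ('m \<times> 'n) ^ ('m \<times> 'n) \<Rightarrow>
   real ^ ('m \<times> 'n) ^ ('m \<times> 'n) \<Rightarrow> real ^ ('m \<times> 'n) \<Rightarrow> real ^ 'm \<Rightarrow> real ^ 'n \<Rightarrow>
   real ^ ('m \<times> 'n) ^ ('m \<times> 'n) \<Rightarrow> ('m \<Rightarrow> real ^ ('m \<times> 'n)) \<Rightarrow> ('n \<Rightarrow> real ^ ('m \<times> 'n)) \<Rightarrow>
   real ^ 'n ^ 'm \<Rightarrow> real ^ ('m \<times> 'n) ^ ('m \<times> 'n) \<Rightarrow> real" where
  "gwpp_lagrangian \<alpha> \<beta> L Y z lam mu Z \<eta> \<theta> \<pi> P =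
     trace (L ** P)
     - trace (Y ** (P - outer (vectorize \<pi>) (vectorize \<pi>)))
     + (\<Sum>i\<in>UNIV. lam $ i * (\<alpha> $ i - a_vec i \<bullet> vectorize \<pi>))
     + (\<Sum>j\<in>UNIV. mu $ j * (\<beta> $ j - b_vec j \<bullet> vectorize \<pi>))
     + (\<Sum>i\<in>UNIV. \<eta> i \<bullet> (P *v a_vec i - (\<alpha> $ i) *\<^sub>R vectorize \<pi>))
     + (\<Sum>j\<in>UNIV. \<theta> j \<bullet> (P *v b_vec j - (\<beta> $ j) *\<^sub>R vectorize \<pi>))
     - trace (Z ** P)
     - z \<bullet> vectorize \<pi>"

definition gwpp_multipliers ::
  "((real ^ ('m::finite \<times> 'n::finite) ^ ('m \<times> 'n)) \<times> (real ^ ('m \<times> 'n)) \<times> (real ^ 'm) \<times> (real ^ 'n) \<times>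
    (real ^ ('m \<times> 'n) ^ ('m \<times> 'n)) \<times> ('m \<Rightarrow> (real ^ ('m \<times> 'n))) \<times> ('n \<Rightarrow> (real ^ ('m \<times> 'n)))) set" where
  "gwpp_multipliers = {(Y, z, lam, mu, Z, \<eta>, \<theta>). symmetric Y \<and> 0 \<le> z \<and> symmetric Z \<and> 0 \<le> Z}"

definition dual_function ::
  "real ^ 'm \<Rightarrow> real ^ 'n \<Rightarrow> real ^ ('m \<times> 'n) ^ ('m \<times> 'n) \<Rightarrow>
   real ^ ('m \<times> 'n) ^ ('m \<times> 'n) \<Rightarrow> real ^ ('m \<times> 'n) \<Rightarrow> real ^ 'm \<Rightarrow> real ^ 'n \<Rightarrow>
   real ^ ('m \<times> 'n) ^ ('m \<times> 'n) \<Rightarrow> ('m \<Rightarrow> real ^ ('m \<times> 'n)) \<Rightarrow> ('n \<Rightarrow> real ^ ('m \<times> 'n)) \<Rightarrow>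
   ereal" where
  "dual_function \<alpha> \<beta> L Y z lam mu Z \<eta> \<theta> =
     (INF (\<pi>, P) \<in> UNIV \<times> {P. symmetric P}. ereal (gwpp_lagrangian \<alpha> \<beta> L Y z lam mu Z \<eta> \<theta> \<pi> P))"

definition gw_dual_objective ::
  "real ^ 'm \<Rightarrow> real ^ 'n \<Rightarrow> real ^ 'm \<Rightarrow> real ^ 'n \<Rightarrow> real \<Rightarrow> real" where
  "gw_dual_objective \<alpha> \<beta> lam mu t = lam \<bullet> \<alpha> + mu \<bullet> \<beta> - t"

definition gw_dual_feasible ::
  "real ^ 'm \<Rightarrow> real ^ 'n \<Rightarrow> real ^ ('m \<times> 'n) ^ ('m \<times> 'n) \<Rightarrow>
   real ^ 'm \<Rightarrow> real ^ 'n \<Rightarrow> real ^ ('m \<times> 'n) ^ ('m \<times> 'n) \<Rightarrow>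
   ('m \<Rightarrow> real ^ ('m \<times> 'n)) \<Rightarrow> ('n \<Rightarrow> real ^ ('m \<times> 'n)) \<Rightarrow>
   real ^ ('m \<times> 'n) \<Rightarrow> real \<Rightarrow> bool" where
  "gw_dual_feasible \<alpha> \<beta> L lam mu Z \<eta> \<theta> y t \<longleftrightarrow>
     psd (bordered
       (L - Z + (1/2) *\<^sub>R (\<Sum>i\<in>UNIV. outer (\<eta> i) (a_vec i) + outer (a_vec i) (\<eta> i))
              + (1/2) *\<^sub>R (\<Sum>j\<in>UNIV. outer (\<theta> j) (b_vec j) + outer (b_vec j) (\<theta> j)))
       y t) \<and>
     (\<Sum>i\<in>UNIV. (lam $ i) *\<^sub>R a_vec i + (\<alpha> $ i) *\<^sub>R \<eta> i)
       + (\<Sum>j\<in>UNIV. (mu $ j) *\<^sub>R b_vec j + (\<beta> $ j) *\<^sub>R \<theta> j) + 2 *\<^sub>R y \<le> 0 \<and>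
     symmetric Z \<and> 0 \<le> Z"

end

theory Submission
  imports Defs
begin

text \<open>
  The Lagrangian is affine in the multipliers. Inserting the constraint residuals themselves
  (negative parts, for the sign constraints) as multipliers gives a sum of squares that vanishes
  exactly at feasible points; scaling it drives the Lagrangian to infinity elsewhere.

  As a function of the primal variables the Lagrangian is $c + \langle M - Y, P\rangle + v^\top Y
  v - (w+z)^\top v$ with $v = \mathrm{vec}(\pi)$, where $M$ is the upper left block of the
  semidefinite constraint and $w + 2y \le 0$ is the linear one, so the dual function is $-\infty$
  unless $Y = M$. In that case a bound $v^\top M v + 2 y^\top v + t \ge 0$ for all $v$, with $2y =
  -(w+z)$, is by homogenization the semidefiniteness of the bordered matrix, and $z \ge 0$ turns
  into $w + 2y \le 0$.
\<close>

section \<open>Symmetric matrices and the trace pairing\<close>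

lemma symmetric_nth: "symmetric A \<Longrightarrow> A $ i $ j = A $ j $ i"
  by (simp add: symmetric_def transpose_def vec_eq_iff)

lemma symmetricI: "(\<And>i j. A $ i $ j = A $ j $ i) \<Longrightarrow> symmetric A"
  by (simp add: symmetric_def transpose_def vec_eq_iff)

lemma symmetric_scaleR: "symmetric A \<Longrightarrow> symmetric (c *\<^sub>R A)"
  by (intro symmetricI) (simp add: symmetric_nth)

lemma symmetric_diff: "symmetric A \<Longrightarrow> symmetric B \<Longrightarrow> symmetric (A - B)"
  by (intro symmetricI) (simp add: symmetric_nth)

lemma symmetric_add: "symmetric A \<Longrightarrow> symmetric B \<Longrightarrow> symmetric (A + B)"
  by (intro symmetricI) (simp add: symmetric_nth)

lemma symmetric_zero: "symmetric 0"
  by (intro symmetricI) simp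

lemma symmetric_sum: "(\<And>i. i \<in> I \<Longrightarrow> symmetric (A i)) \<Longrightarrow> symmetric (\<Sum>i\<in>I. A i)"
  by (induction I rule: infinite_finite_induct) (auto intro: symmetric_add symmetric_zero)

lemma symmetric_outer_self: "symmetric (outer u u)"
  by (intro symmetricI) (simp add: outer_def mult.commute)

lemma symmetric_outer_commute: "symmetric (outer u v + outer v u)"
  by (intro symmetricI) (simp add: outer_def algebra_simps)

lemma symmetric_cost_matrix:
  "symmetric C \<Longrightarrow> symmetric D \<Longrightarrow> symmetric (cost_matrix l C D)"
  by (intro symmetricI) (simp add: cost_matrix_def symmetric_nth)

text \<open>The inner product of nested vectors is the entrywise one, so trace terms become inner
  products and obey the bilinear algebra of \<open>\<bullet>\<close>.\<close>

lemma trace_transpose_mult: "trace (transpose A ** B) = A \<bullet> B"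
  for A B :: "real ^ 'k ^ 'l"
proof -
  have "trace (transpose A ** B) = (\<Sum>i\<in>UNIV. \<Sum>k\<in>UNIV. A $ k $ i * B $ k $ i)"
    by (simp add: trace_def matrix_matrix_mult_def transpose_def)
  also have "\<dots> = (\<Sum>k\<in>UNIV. \<Sum>i\<in>UNIV. A $ k $ i * B $ k $ i)"
    by (rule sum.swap)
  finally show ?thesis
    by (simp add: inner_vec_def)
qed

lemma trace_mult_symmetric: "symmetric A \<Longrightarrow> trace (A ** B) = A \<bullet> B"
  for A B :: "real ^ 'k ^ 'k"
  using trace_transpose_mult[of A B] by (simp add: symmetric_def)

lemma outer_inner: "outer u v \<bullet> P = u \<bullet> (P *v v)"
  for u :: "real ^ 'a" and v :: "real ^ 'b"
  by (simp add: inner_vec_def outer_def matrix_vector_mult_def sum_distrib_left algebra_simps)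

lemma inner_symmetric_commute: "symmetric P \<Longrightarrow> u \<bullet> (P *v v) = v \<bullet> (P *v u)"
  for P :: "real ^ 'k ^ 'k"
  by (metis dot_lmul_matrix inner_commute symmetric_def transpose_matrix_vector)

section \<open>Vectorized couplings and their marginals\<close>

lemma a_vec_inner_vectorize: "a_vec i \<bullet> vectorize \<pi> = (\<pi> *v 1) $ i"
  for \<pi> :: "real ^ 'n ^ 'm"
proof -
  have "a_vec i \<bullet> vectorize \<pi> = (\<Sum>p\<in>UNIV \<times> UNIV. axis i 1 $ fst p * \<pi> $ fst p $ snd p)"
    by (simp add: a_vec_def vectorize_def outer_def inner_vec_def)
  also have "\<dots> = (\<Sum>k\<in>UNIV. \<Sum>j\<in>UNIV. axis i 1 $ k * \<pi> $ k $ j)"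
    by (subst sum.cartesian_product) (simp add: case_prod_unfold)
  also have "\<dots> = (\<Sum>k\<in>UNIV. if k = i then \<Sum>j\<in>UNIV. \<pi> $ k $ j else 0)"
    by (intro sum.cong) (auto simp: axis_def)
  finally show ?thesis
    by (simp add: matrix_vector_mult_def)
qed

lemma b_vec_inner_vectorize: "b_vec j \<bullet> vectorize \<pi> = (transpose \<pi> *v 1) $ j"
  for \<pi> :: "real ^ 'n ^ 'm"
proof -
  have "b_vec j \<bullet> vectorize \<pi> = (\<Sum>p\<in>UNIV \<times> UNIV. axis j 1 $ snd p * \<pi> $ fst p $ snd p)"
    by (simp add: b_vec_def vectorize_def outer_def inner_vec_def)
  also have "\<dots> = (\<Sum>i\<in>UNIV. \<Sum>k\<in>UNIV. axis j 1 $ k * \<pi> $ i $ k)"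
    by (subst sum.cartesian_product) (simp add: case_prod_unfold)
  also have "\<dots> = (\<Sum>i\<in>UNIV. \<Sum>k\<in>UNIV. if k = j then \<pi> $ i $ k else 0)"
    by (intro sum.cong) (auto simp: axis_def)
  finally show ?thesis
    by (simp add: matrix_vector_mult_def transpose_def)
qed

text \<open>Turns a bound valid for every \<open>\<pi>\<close> into one valid for every vector, as
  semidefiniteness requires.\<close>

lemma vectorize_surj: "\<exists>\<pi>. vectorize \<pi> = v"
  by (rule exI[of _ "\<chi> i j. v $ (i, j)"]) (simp add: vectorize_def vec_eq_iff)

lemma vectorize_nonneg_iff: "0 \<le> vectorize \<pi> \<longleftrightarrow> 0 \<le> \<pi>" for \<pi> :: "real ^ 'n ^ 'm"
  by (auto simp: vectorize_def less_eq_vec_def)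

section \<open>Entrywise negative parts\<close>

definition neg_part :: "real ^ 'k \<Rightarrow> real ^ 'k" where
  "neg_part v = (\<chi> i. max 0 (- v $ i))"

lemma neg_part_nonneg: "0 \<le> neg_part v"
  by (simp add: neg_part_def less_eq_vec_def)

text \<open>Entrywise, max(0, -x) is either -x or 0. With the negative part as multiplier, a sign
  constraint thus contributes a square to the Lagrangian.\<close>

lemma neg_part_inner: "neg_part v \<bullet> v = - (norm (neg_part v))\<^sup>2"
  unfolding power2_norm_eq_inner inner_vec_def neg_part_def
  by (simp flip: sum_negf) (auto intro!: sum.cong simp: max_def)

lemma neg_part_eq_0_iff: "neg_part v = 0 \<longleftrightarrow> 0 \<le> v"
proof -
  have "max 0 (- x) = 0 \<longleftrightarrow> 0 \<le> x" for x :: real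
    by linarith
  then show ?thesis
    by (simp add: neg_part_def vec_eq_iff less_eq_vec_def)
qed

definition neg_part_matrix :: "real ^ 'k ^ 'l \<Rightarrow> real ^ 'k ^ 'l" where
  "neg_part_matrix A = (\<chi> i. neg_part (A $ i))"

lemma neg_part_matrix_nonneg: "0 \<le> neg_part_matrix A"
  by (simp add: neg_part_matrix_def neg_part_nonneg less_eq_vec_def[of "0 :: real ^ _ ^ _"])

lemma symmetric_neg_part_matrix: "symmetric A \<Longrightarrow> symmetric (neg_part_matrix A)"
  by (intro symmetricI) (simp add: neg_part_matrix_def neg_part_def symmetric_nth)

lemma neg_part_matrix_inner: "neg_part_matrix A \<bullet> A = - (norm (neg_part_matrix A))\<^sup>2"
  unfolding power2_norm_eq_inner inner_vec_def[of "neg_part_matrix A"]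
  by (simp add: neg_part_matrix_def neg_part_inner power2_norm_eq_inner sum_negf)

lemma neg_part_matrix_eq_0_iff: "neg_part_matrix A = 0 \<longleftrightarrow> 0 \<le> A"
  by (simp add: neg_part_matrix_def vec_eq_iff[of _ "0 :: real ^ _ ^ _"] neg_part_eq_0_iff
      less_eq_vec_def[of "0 :: real ^ _ ^ _"])

section \<open>Semidefiniteness of bordered matrices\<close>

lemma quadratic_nonneg_imp_leading_nonneg:
  fixes a b c :: real
  assumes "\<And>k. 0 \<le> k\<^sup>2 * a + k * b + c"
  shows "0 \<le> a"
proof (rule ccontr)
  assume "\<not> 0 \<le> a"
  \<comment> \<open>This k makes the leading term equal to -(\<bar>c\<bar> + 1). Using both k and -k
    cancels the linear term, leaving c \<ge> \<bar>c\<bar> + 1.\<close>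
  then have "(sqrt ((\<bar>c\<bar> + 1) / (- a)))\<^sup>2 * a = - (\<bar>c\<bar> + 1)"
    by (subst real_sqrt_pow2) (auto simp: divide_nonneg_neg divide_nonneg_nonneg)
  then show False
    using assms[of "sqrt ((\<bar>c\<bar> + 1) / (- a))"] assms[of "- sqrt ((\<bar>c\<bar> + 1) / (- a))"]
    by simp
qed

lemma bordered_quadratic_form:
  fixes M :: "real ^ 'k ^ 'k"
  defines "v \<equiv> (\<lambda>x :: real ^ ('k + unit). (\<chi> i. x $ Inl i) :: real ^ 'k)"
  shows "x \<bullet> (bordered M y t *v x)
    = v x \<bullet> (M *v v x) + 2 * x $ Inr () * (y \<bullet> v x) + t * (x $ Inr ())\<^sup>2"
proof -
  have split: "(\<Sum>p\<in>UNIV. f p) = (\<Sum>i\<in>UNIV. f (Inl i)) + f (Inr ())" for f :: "'k + unit \<Rightarrow> real"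
    by (simp add: UNIV_Plus_UNIV[symmetric] sum.Plus UNIV_unit del: UNIV_Plus_UNIV)
  show ?thesis
    unfolding v_def inner_vec_def matrix_vector_mult_def bordered_def
    by (simp add: split sum.distrib sum_distrib_left algebra_simps power2_eq_square)
qed

lemma symmetric_bordered: "symmetric (bordered M y t) \<longleftrightarrow> symmetric M"
proof
  assume "symmetric (bordered M y t)"
  then have "bordered M y t $ Inl i $ Inl j = bordered M y t $ Inl j $ Inl i" for i j
    by (rule symmetric_nth)
  then show "symmetric M"
    by (intro symmetricI) (simp add: bordered_def)
next
  assume "symmetric M"
  then show "symmetric (bordered M y t)"
    by (intro symmetricI) (auto simp: bordered_def symmetric_nth split: sum.split)
qed

text \<open>The inhomogeneous bound is the quadratic form of the bordered matrix at last coordinate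
  1. Homogeneity extends it to every nonzero last coordinate; at last coordinate 0 only the leading
  term remains, whose sign follows from large multiples of \<open>v\<close>.\<close>

lemma psd_bordered_iff:
  fixes M :: "real ^ 'k ^ 'k"
  shows "psd (bordered M y t)
    \<longleftrightarrow> symmetric M \<and> (\<forall>v. 0 \<le> v \<bullet> (M *v v) + 2 * (y \<bullet> v) + t)"
proof (intro iffI conjI allI)
  assume psd: "psd (bordered M y t)"
  then show "symmetric M"
    by (simp add: psd_def symmetric_bordered)
  fix v
  define x :: "real ^ ('k + unit)" where "x = (\<chi> p. case p of Inl i \<Rightarrow> v $ i | Inr _ \<Rightarrow> 1)"
  have "(\<chi> i. x $ Inl i) = v" "x $ Inr () = 1"
    by (simp_all add: x_def vec_eq_iff)
  then show "0 \<le> v \<bullet> (M *v v) + 2 * (y \<bullet> v) + t"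
    using psd[unfolded psd_def, THEN conjunct2, rule_format, of x] bordered_quadratic_form[of x M y t]
    by simp
next
  assume asm: "symmetric M \<and> (\<forall>v. 0 \<le> v \<bullet> (M *v v) + 2 * (y \<bullet> v) + t)"
  \<comment> \<open>The factor \<open>k\<close> is free: all of its values together control the
    leading coefficient, and \<open>k = 1/s\<close> gives the form at last coordinate
    \<open>s\<close>.\<close>
  have scaled: "0 \<le> k\<^sup>2 * (v \<bullet> (M *v v)) + k * (2 * (y \<bullet> v)) + t" for k v
    using asm[THEN conjunct2, rule_format, of "k *\<^sub>R v"]
    by (simp add: matrix_vector_mult_scaleR power2_eq_square algebra_simps)
  have "0 \<le> v \<bullet> (M *v v) + 2 * s * (y \<bullet> v) + t * s\<^sup>2" for v s
  proof (cases "s = 0")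
    case True
    then show ?thesis
      using quadratic_nonneg_imp_leading_nonneg[OF scaled] by simp
  next
    case False
    have "v \<bullet> (M *v v) + 2 * s * (y \<bullet> v) + t * s\<^sup>2
      = s\<^sup>2 * ((1/s)\<^sup>2 * (v \<bullet> (M *v v)) + (1/s) * (2 * (y \<bullet> v)) + t)"
      using False by (simp add: field_simps power2_eq_square)
    then show ?thesis
      using scaled[of "1/s" v] by simp
  qed
  then show "psd (bordered M y t)"
    using asm unfolding psd_def symmetric_bordered by (simp add: bordered_quadratic_form)
qed

section \<open>The Lagrangian grouped by multipliers and by primal variables\<close>

definition dual_matrix ::
  "real ^ ('m::finite \<times> 'n::finite) ^ ('m \<times> 'n) \<Rightarrow> real ^ ('m \<times> 'n) ^ ('m \<times> 'n) \<Rightarrow>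
   ('m \<Rightarrow> real ^ ('m \<times> 'n)) \<Rightarrow> ('n \<Rightarrow> real ^ ('m \<times> 'n)) \<Rightarrow> real ^ ('m \<times> 'n) ^ ('m \<times> 'n)" where
  "dual_matrix L Z \<eta> \<theta> =
     L - Z + (1/2) *\<^sub>R (\<Sum>i\<in>UNIV. outer (\<eta> i) (a_vec i) + outer (a_vec i) (\<eta> i))
           + (1/2) *\<^sub>R (\<Sum>j\<in>UNIV. outer (\<theta> j) (b_vec j) + outer (b_vec j) (\<theta> j))"

text \<open>Apart from \<open>z\<close>, this is minus the coefficient of
  \<open>vectorize \<pi>\<close> in the linear part of the Lagrangian.\<close>

definition dual_vector ::
  "real ^ 'm \<Rightarrow> real ^ 'n \<Rightarrow> real ^ 'm \<Rightarrow> real ^ 'n \<Rightarrow>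
   ('m::finite \<Rightarrow> real ^ ('m \<times> 'n::finite)) \<Rightarrow> ('n \<Rightarrow> real ^ ('m \<times> 'n)) \<Rightarrow> real ^ ('m \<times> 'n)" where
  "dual_vector \<alpha> \<beta> lam mu \<eta> \<theta> =
     (\<Sum>i\<in>UNIV. (lam $ i) *\<^sub>R a_vec i + (\<alpha> $ i) *\<^sub>R \<eta> i)
       + (\<Sum>j\<in>UNIV. (mu $ j) *\<^sub>R b_vec j + (\<beta> $ j) *\<^sub>R \<theta> j)"

lemma symmetric_dual_matrix:
  "symmetric L \<Longrightarrow> symmetric Z \<Longrightarrow> symmetric (dual_matrix L Z \<eta> \<theta>)"
  unfolding dual_matrix_def
  by (intro symmetric_add symmetric_diff symmetric_scaleR symmetric_sum symmetric_outer_commute)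

lemma gw_dual_feasible_iff:
  "gw_dual_feasible \<alpha> \<beta> L lam mu Z \<eta> \<theta> y t \<longleftrightarrow>
     psd (bordered (dual_matrix L Z \<eta> \<theta>) y t) \<and>
     dual_vector \<alpha> \<beta> lam mu \<eta> \<theta> + 2 *\<^sub>R y \<le> 0 \<and> symmetric Z \<and> 0 \<le> Z"
  by (simp add: gw_dual_feasible_def dual_matrix_def dual_vector_def)

text \<open>Groups the terms by multiplier, each paired with the residual of its constraint. This is
  the form for taking suprema over multipliers at a fixed primal point.\<close>

lemma lagrangian_residual_form:
  assumes "symmetric L" "symmetric Y" "symmetric Z"
  shows "gwpp_lagrangian \<alpha> \<beta> L Y z lam mu Z \<eta> \<theta> \<pi> P =
     L \<bullet> P - Y \<bullet> (P - outer (vectorize \<pi>) (vectorize \<pi>))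
     + lam \<bullet> (\<alpha> - \<pi> *v 1) + mu \<bullet> (\<beta> - transpose \<pi> *v 1)
     + (\<Sum>i\<in>UNIV. \<eta> i \<bullet> (P *v a_vec i - (\<alpha> $ i) *\<^sub>R vectorize \<pi>))
     + (\<Sum>j\<in>UNIV. \<theta> j \<bullet> (P *v b_vec j - (\<beta> $ j) *\<^sub>R vectorize \<pi>))
     - Z \<bullet> P - z \<bullet> vectorize \<pi>"
  using assms
  by (simp add: gwpp_lagrangian_def trace_mult_symmetric a_vec_inner_vectorize
      b_vec_inner_vectorize inner_vec_def[of lam] inner_vec_def[of mu])

text \<open>Groups the terms by primal variable, for taking infima at fixed multipliers: affine in
  \<open>P\<close>, quadratic in \<open>vectorize \<pi>\<close>, with no mixed terms.\<close>

lemma lagrangian_quadratic_form: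
  assumes "symmetric L" "symmetric Y" "symmetric Z" "symmetric P"
  shows "gwpp_lagrangian \<alpha> \<beta> L Y z lam mu Z \<eta> \<theta> \<pi> P =
     lam \<bullet> \<alpha> + mu \<bullet> \<beta> + (dual_matrix L Z \<eta> \<theta> - Y) \<bullet> P
     + vectorize \<pi> \<bullet> (Y *v vectorize \<pi>)
     - (dual_vector \<alpha> \<beta> lam mu \<eta> \<theta> + z) \<bullet> vectorize \<pi>"
proof -
  define v where "v = vectorize \<pi>"
  \<comment> \<open>Symmetry of \<open>P\<close> makes both outer products contribute equally, which
    accounts for the factors 1/2 in \<open>dual_matrix\<close>.\<close>
  have half: "(1/2) * ((outer u w + outer w u) \<bullet> P) = u \<bullet> (P *v w)" for u w
    using inner_symmetric_commute[OF assms(4), of u w] by (simp add: inner_add_left outer_inner)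
  have M: "dual_matrix L Z \<eta> \<theta> \<bullet> P =
      L \<bullet> P - Z \<bullet> P + (\<Sum>i\<in>UNIV. \<eta> i \<bullet> (P *v a_vec i)) + (\<Sum>j\<in>UNIV. \<theta> j \<bullet> (P *v b_vec j))"
    unfolding dual_matrix_def inner_add_left inner_diff_left inner_scaleR_left inner_sum_left
      sum_distrib_left half[unfolded inner_add_left] ..
  have w: "dual_vector \<alpha> \<beta> lam mu \<eta> \<theta> \<bullet> v =
      (\<Sum>i\<in>UNIV. lam $ i * (a_vec i \<bullet> v)) + (\<Sum>i\<in>UNIV. \<alpha> $ i * (\<eta> i \<bullet> v))
      + (\<Sum>j\<in>UNIV. mu $ j * (b_vec j \<bullet> v)) + (\<Sum>j\<in>UNIV. \<beta> $ j * (\<theta> j \<bullet> v))"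
    by (simp add: dual_vector_def inner_add_left inner_sum_left sum.distrib)
  show ?thesis
    unfolding gwpp_lagrangian_def v_def[symmetric] inner_diff_left inner_add_left M w
    using assms
    by (simp add: trace_mult_symmetric inner_diff_right right_diff_distrib sum_subtractf
        inner_commute[of Y "outer v v"] outer_inner inner_vec_def[of lam] inner_vec_def[of mu])
qed

section \<open>Supremum of the Lagrangian over the multipliers\<close>

lemma SUP_eq_PInfty_if_affine_growth:
  fixes r g :: real
  assumes "0 < g" and "\<And>c. 0 \<le> c \<Longrightarrow> \<exists>x\<in>A. ereal (r + c * g) \<le> f x"
  shows "(SUP x\<in>A. f x) = \<infinity>"
proof (rule ereal_top)
  fix B :: real
  \<comment> \<open>The value of \<open>c\<close> at which \<open>r + c * g\<close> reaches
    \<open>B\<close>, clipped at 0 because only nonnegative scalings preserve the sign conditions on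
    \<open>z\<close> and \<open>Z\<close>.\<close>
  define c where "c = max 0 ((B - r) / g)"
  have "(B - r) / g \<le> c" "0 \<le> c"
    by (auto simp: c_def)
  then have "B \<le> r + c * g"
    using \<open>0 < g\<close> by (simp add: pos_divide_le_eq algebra_simps)
  with assms(2)[OF \<open>0 \<le> c\<close>] show "ereal B \<le> (SUP x\<in>A. f x)"
    by (meson SUP_upper ereal_less_eq(3) order_trans)
qed

text \<open>At a feasible point all equality residuals vanish, and the two remaining terms, in
  \<open>z\<close> and \<open>Z\<close>, can only lower the value. Zero multipliers attain the
  objective.\<close>

lemma SUP_lagrangian_feasible:
  assumes "symmetric L" and feas: "gwpp_feasible \<alpha> \<beta> \<pi> P"
  shows "(SUP (Y, z, lam, mu, Z, \<eta>, \<theta>) \<in> gwpp_multipliers.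
           ereal (gwpp_lagrangian \<alpha> \<beta> L Y z lam mu Z \<eta> \<theta> \<pi> P)) = ereal (gwpp_objective L P)"
proof (rule antisym)
  have nonneg: "0 \<le> z \<bullet> vectorize \<pi>" "0 \<le> Z \<bullet> P" if "0 \<le> z" "0 \<le> Z" for z Z
    using feas that
    by (auto simp: gwpp_feasible_def couplings_def vectorize_def less_eq_vec_def inner_vec_def
        outer_def intro!: sum_nonneg mult_nonneg_nonneg)
  have lagrangian: "gwpp_lagrangian \<alpha> \<beta> L Y z lam mu Z \<eta> \<theta> \<pi> P
      = gwpp_objective L P - Z \<bullet> P - z \<bullet> vectorize \<pi>"
    if "symmetric Y" "symmetric Z" for Y z lam mu Z \<eta> \<theta>
  proof -
    have zero: "\<eta> i \<bullet> (P *v a_vec i - (\<alpha> $ i) *\<^sub>R vectorize \<pi>) = 0"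
      "\<theta> j \<bullet> (P *v b_vec j - (\<beta> $ j) *\<^sub>R vectorize \<pi>) = 0" for i j
      using feas unfolding gwpp_feasible_def by (metis diff_self inner_zero_right)+
    have "P - outer (vectorize \<pi>) (vectorize \<pi>) = 0" "\<alpha> - \<pi> *v 1 = 0" "\<beta> - transpose \<pi> *v 1 = 0"
      using feas by (simp_all add: gwpp_feasible_def couplings_def)
    then show ?thesis
      unfolding lagrangian_residual_form[OF assms(1) that] zero
      by (simp add: gwpp_objective_def trace_transpose_mult)
  qed
  show "(SUP (Y, z, lam, mu, Z, \<eta>, \<theta>) \<in> gwpp_multipliers.
           ereal (gwpp_lagrangian \<alpha> \<beta> L Y z lam mu Z \<eta> \<theta> \<pi> P)) \<le> ereal (gwpp_objective L P)"
    by (rule SUP_least) (use nonneg in \<open>fastforce simp: gwpp_multipliers_def lagrangian\<close>)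
  have "(0, 0, 0, 0, 0, \<lambda>_. 0, \<lambda>_. 0) \<in> gwpp_multipliers"
    by (simp add: gwpp_multipliers_def symmetric_zero)
  from SUP_upper[OF this] show "ereal (gwpp_objective L P) \<le>
      (SUP (Y, z, lam, mu, Z, \<eta>, \<theta>) \<in> gwpp_multipliers.
           ereal (gwpp_lagrangian \<alpha> \<beta> L Y z lam mu Z \<eta> \<theta> \<pi> P))"
    by (rule order_trans[rotated]) (simp add: lagrangian symmetric_zero)
qed

lemma SUP_lagrangian_infeasible:
  assumes "symmetric L" "symmetric P" and infeas: "\<not> gwpp_feasible \<alpha> \<beta> \<pi> P"
  shows "(SUP (Y, z, lam, mu, Z, \<eta>, \<theta>) \<in> gwpp_multipliers.
           ereal (gwpp_lagrangian \<alpha> \<beta> L Y z lam mu Z \<eta> \<theta> \<pi> P)) = \<infinity>"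
proof -
  \<comment> \<open>Here the sign is opposite to the residual
    \<open>P - outer (vectorize \<pi>) (vectorize \<pi>)\<close>, since \<open>Y\<close> enters the
    Lagrangian with a minus sign.\<close>
  define Y where "Y = outer (vectorize \<pi>) (vectorize \<pi>) - P"
  define z where "z = neg_part (vectorize \<pi>)"
  define lam where "lam = \<alpha> - \<pi> *v 1"
  define mu where "mu = \<beta> - transpose \<pi> *v 1"
  define Z where "Z = neg_part_matrix P"
  define \<eta> where "\<eta> i = P *v a_vec i - (\<alpha> $ i) *\<^sub>R vectorize \<pi>" for i
  define \<theta> where "\<theta> j = P *v b_vec j - (\<beta> $ j) *\<^sub>R vectorize \<pi>" for j
  define g where "g = (norm Y)\<^sup>2 + (norm lam)\<^sup>2 + (norm mu)\<^sup>2 + (\<Sum>i\<in>UNIV. (norm (\<eta> i))\<^sup>2)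
    + (\<Sum>j\<in>UNIV. (norm (\<theta> j))\<^sup>2) + (norm Z)\<^sup>2 + (norm z)\<^sup>2"
  have symm: "symmetric Y" "symmetric Z"
    using assms(2) by (simp_all add: Y_def Z_def symmetric_diff symmetric_outer_self
        symmetric_neg_part_matrix)
  \<comment> \<open>A sum of squares that is not positive has all its terms zero, and the vanishing
    of every residual and negative part is feasibility.\<close>
  have "0 < g"
  proof (rule ccontr)
    assume "\<not> 0 < g"
    moreover have "0 \<le> (\<Sum>i\<in>UNIV. (norm (\<eta> i))\<^sup>2)" "0 \<le> (\<Sum>j\<in>UNIV. (norm (\<theta> j))\<^sup>2)"
      by (simp_all add: sum_nonneg)
    moreover have "0 \<le> (norm Y)\<^sup>2" "0 \<le> (norm lam)\<^sup>2" "0 \<le> (norm mu)\<^sup>2" "0 \<le> (norm Z)\<^sup>2" "0 \<le> (norm z)\<^sup>2"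
      by simp_all
    ultimately have "(norm Y)\<^sup>2 = 0" "(norm lam)\<^sup>2 = 0" "(norm mu)\<^sup>2 = 0" "(norm Z)\<^sup>2 = 0"
      "(norm z)\<^sup>2 = 0" "(\<Sum>i\<in>UNIV. (norm (\<eta> i))\<^sup>2) = 0" "(\<Sum>j\<in>UNIV. (norm (\<theta> j))\<^sup>2) = 0"
      unfolding g_def by linarith+
    then have "Y = 0" "lam = 0" "mu = 0" "Z = 0" "z = 0" "\<And>i. \<eta> i = 0" "\<And>j. \<theta> j = 0"
      by (simp_all add: sum_nonneg_eq_0_iff)
    then have "gwpp_feasible \<alpha> \<beta> \<pi> P"
      unfolding Y_def lam_def mu_def Z_def z_def \<eta>_def \<theta>_def
      by (simp add: gwpp_feasible_def couplings_def neg_part_eq_0_iff neg_part_matrix_eq_0_iff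
          vectorize_nonneg_iff)
    with infeas show False ..
  qed
  \<comment> \<open>Multiplying all chosen multipliers by \<open>c\<close> keeps them admissible and
    turns their contribution into \<open>c * g\<close>.\<close>
  moreover have "\<exists>x\<in>gwpp_multipliers. ereal (L \<bullet> P + c * g) \<le>
      (case x of (Y, z, lam, mu, Z, \<eta>, \<theta>) \<Rightarrow> ereal (gwpp_lagrangian \<alpha> \<beta> L Y z lam mu Z \<eta> \<theta> \<pi> P))"
    if "0 \<le> c" for c
  proof
    show "(c *\<^sub>R Y, c *\<^sub>R z, c *\<^sub>R lam, c *\<^sub>R mu, c *\<^sub>R Z, \<lambda>i. c *\<^sub>R \<eta> i, \<lambda>j. c *\<^sub>R \<theta> j)
        \<in> gwpp_multipliers"
      using symm that neg_part_nonneg[of "vectorize \<pi>"] neg_part_matrix_nonneg[of P]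
      by (simp add: gwpp_multipliers_def symmetric_scaleR z_def Z_def less_eq_vec_def)
    have Y: "P - outer (vectorize \<pi>) (vectorize \<pi>) = - Y"
      by (simp add: Y_def)
    have "gwpp_lagrangian \<alpha> \<beta> L (c *\<^sub>R Y) (c *\<^sub>R z) (c *\<^sub>R lam) (c *\<^sub>R mu) (c *\<^sub>R Z)
        (\<lambda>i. c *\<^sub>R \<eta> i) (\<lambda>j. c *\<^sub>R \<theta> j) \<pi> P = L \<bullet> P + c * g"
      unfolding lagrangian_residual_form[OF assms(1) symm[THEN symmetric_scaleR]] Y
        lam_def[symmetric] mu_def[symmetric] \<eta>_def[symmetric] \<theta>_def[symmetric]
        inner_scaleR_left g_def
      using neg_part_inner[of "vectorize \<pi>"] neg_part_matrix_inner[of P]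
      by (simp add: z_def[symmetric] Z_def[symmetric] power2_norm_eq_inner
          sum_distrib_left[symmetric] distrib_left)
    then show "ereal (L \<bullet> P + c * g) \<le>
      (case (c *\<^sub>R Y, c *\<^sub>R z, c *\<^sub>R lam, c *\<^sub>R mu, c *\<^sub>R Z, \<lambda>i. c *\<^sub>R \<eta> i, \<lambda>j. c *\<^sub>R \<theta> j) of
        (Y, z, lam, mu, Z, \<eta>, \<theta>) \<Rightarrow> ereal (gwpp_lagrangian \<alpha> \<beta> L Y z lam mu Z \<eta> \<theta> \<pi> P))"
      by simp
  qed
  ultimately show ?thesis
    by (rule SUP_eq_PInfty_if_affine_growth)
qed

section \<open>The dual function compared with (GW-Dual)\<close>

lemma dual_function_eq_MInfty:
  assumes "symmetric L" "symmetric Y" "symmetric Z" and "Y \<noteq> dual_matrix L Z \<eta> \<theta>"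
  shows "dual_function \<alpha> \<beta> L Y z lam mu Z \<eta> \<theta> = -\<infinity>"
proof -
  define N where "N = dual_matrix L Z \<eta> \<theta> - Y"
  define r where "r = lam \<bullet> \<alpha> + mu \<bullet> \<beta>"
  have N: "symmetric N" "0 < N \<bullet> N"
    using assms by (simp_all add: N_def symmetric_diff symmetric_dual_matrix)
  have vec0: "vectorize 0 = 0"
    by (simp add: vectorize_def vec_eq_iff)
  \<comment> \<open>Along \<open>\<pi> = 0\<close>, \<open>P = c *\<^sub>R N\<close> the Lagrangian
    is affine in \<open>c\<close> with positive slope. Since \<open>P\<close> has no sign
    restriction in the infimum, \<open>c\<close> may be any real number.\<close>
  have upper: "dual_function \<alpha> \<beta> L Y z lam mu Z \<eta> \<theta> \<le> ereal (r + c * (N \<bullet> N))" for c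
  proof -
    have "symmetric (c *\<^sub>R N)"
      using N by (simp add: symmetric_scaleR)
    then have "dual_function \<alpha> \<beta> L Y z lam mu Z \<eta> \<theta>
        \<le> ereal (gwpp_lagrangian \<alpha> \<beta> L Y z lam mu Z \<eta> \<theta> 0 (c *\<^sub>R N))"
      unfolding dual_function_def by (intro INF_lower2[of "(0, c *\<^sub>R N)"]) auto
    also have "\<dots> = ereal (r + c * (N \<bullet> N))"
      using assms(1-3) \<open>symmetric (c *\<^sub>R N)\<close>
      by (simp add: lagrangian_quadratic_form vec0 r_def N_def[symmetric])
    finally show ?thesis .
  qed
  have "dual_function \<alpha> \<beta> L Y z lam mu Z \<eta> \<theta> \<le> ereal B" for B
    using upper[of "(B - r) / (N \<bullet> N)"] N(2) by simp
  then show ?thesis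
    by (rule ereal_bot)
qed

text \<open>The choice \<open>Y = M\<close> removes \<open>P\<close> from the Lagrangian. Taking for
  \<open>z\<close> the slack of the linear constraint turns the linear coefficient
  \<open>- (w + z)\<close> into \<open>2 *\<^sub>R y\<close>; semidefiniteness then bounds the part
  depending on \<open>\<pi>\<close> below by \<open>- t\<close>.\<close>

lemma dual_function_ge_gw_dual_objective:
  fixes L :: "real ^ ('m::finite \<times> 'n::finite) ^ ('m \<times> 'n)"
  assumes "symmetric L" and "gw_dual_feasible \<alpha> \<beta> L lam mu Z \<eta> \<theta> y t"
  shows "\<exists>Y z. symmetric Y \<and> 0 \<le> z \<and>
    ereal (gw_dual_objective \<alpha> \<beta> lam mu t) \<le> dual_function \<alpha> \<beta> L Y z lam mu Z \<eta> \<theta>"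
proof -
  define M where "M = dual_matrix L Z \<eta> \<theta>"
  define w where "w = dual_vector \<alpha> \<beta> lam mu \<eta> \<theta>"
  have psd: "psd (bordered M y t)" and w: "w + 2 *\<^sub>R y \<le> 0" and Z: "symmetric Z"
    using assms(2) by (auto simp: gw_dual_feasible_iff M_def w_def)
  have M: "symmetric M" and quad: "0 \<le> v \<bullet> (M *v v) + 2 * (y \<bullet> v) + t" for v
    using psd by (auto simp: psd_bordered_iff)
  have "0 \<le> - (w + 2 *\<^sub>R y)"
    using w unfolding less_eq_vec_def vector_uminus_component zero_index neg_0_le_iff_le .
  moreover have "ereal (gw_dual_objective \<alpha> \<beta> lam mu t)
      \<le> dual_function \<alpha> \<beta> L M (- (w + 2 *\<^sub>R y)) lam mu Z \<eta> \<theta>"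
    unfolding dual_function_def
  proof (rule INF_greatest, clarify)
    fix \<pi> :: "real ^ 'n ^ 'm" and P :: "real ^ ('m \<times> 'n) ^ ('m \<times> 'n)"
    assume "symmetric P"
    then have "gwpp_lagrangian \<alpha> \<beta> L M (- (w + 2 *\<^sub>R y)) lam mu Z \<eta> \<theta> \<pi> P
        = lam \<bullet> \<alpha> + mu \<bullet> \<beta> + vectorize \<pi> \<bullet> (M *v vectorize \<pi>) + 2 * (y \<bullet> vectorize \<pi>)"
      using assms(1) M Z
      by (simp add: lagrangian_quadratic_form M_def[symmetric] w_def[symmetric])
    then show "ereal (gw_dual_objective \<alpha> \<beta> lam mu t)
        \<le> ereal (gwpp_lagrangian \<alpha> \<beta> L M (- (w + 2 *\<^sub>R y)) lam mu Z \<eta> \<theta> \<pi> P)"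
      using quad[of "vectorize \<pi>"] by (simp add: gw_dual_objective_def)
  qed
  ultimately show ?thesis
    using M by blast
qed

text \<open>A value other than -\<infinity> forces \<open>Y\<close> to be the upper left block. Then
  \<open>y\<close> is read off the linear coefficient, and \<open>t\<close> is chosen to make the
  objective equal to the dual value; that this value is a lower bound of the Lagrangian is the
  semidefinite constraint.\<close>

lemma dual_function_le_gw_dual_objective:
  fixes L :: "real ^ ('m::finite \<times> 'n::finite) ^ ('m \<times> 'n)"
  assumes "symmetric L" "symmetric Y" "0 \<le> z" "symmetric Z" "0 \<le> Z"
    and finite: "dual_function \<alpha> \<beta> L Y z lam mu Z \<eta> \<theta> \<noteq> -\<infinity>"
  shows "\<exists>y t. gw_dual_feasible \<alpha> \<beta> L lam mu Z \<eta> \<theta> y t \<and>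
    dual_function \<alpha> \<beta> L Y z lam mu Z \<eta> \<theta> \<le> ereal (gw_dual_objective \<alpha> \<beta> lam mu t)"
proof -
  define w where "w = dual_vector \<alpha> \<beta> lam mu \<eta> \<theta>"
  define y where "y = (- 1/2) *\<^sub>R (w + z)"
  have Y: "Y = dual_matrix L Z \<eta> \<theta>"
    using dual_function_eq_MInfty[OF assms(1,2,4)] finite by blast
  have upper: "dual_function \<alpha> \<beta> L Y z lam mu Z \<eta> \<theta>
      \<le> ereal (lam \<bullet> \<alpha> + mu \<bullet> \<beta> + v \<bullet> (Y *v v) + 2 * (y \<bullet> v))" for v
  proof -
    obtain \<pi> :: "real ^ 'n ^ 'm" where "vectorize \<pi> = v"
      using vectorize_surj by blast
    moreover have "dual_function \<alpha> \<beta> L Y z lam mu Z \<eta> \<theta>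
        \<le> ereal (gwpp_lagrangian \<alpha> \<beta> L Y z lam mu Z \<eta> \<theta> \<pi> 0)"
      unfolding dual_function_def by (intro INF_lower2[of "(\<pi>, 0)"]) (auto simp: symmetric_zero)
    ultimately show ?thesis
      using assms(1,2,4) by (simp add: lagrangian_quadratic_form symmetric_zero w_def[symmetric] y_def)
  qed
  \<comment> \<open>The bound at \<open>v = 0\<close> excludes +\<infinity>, and the hypothesis
    excludes -\<infinity>.\<close>
  obtain r where r: "dual_function \<alpha> \<beta> L Y z lam mu Z \<eta> \<theta> = ereal r"
    using upper[of 0] finite by (cases "dual_function \<alpha> \<beta> L Y z lam mu Z \<eta> \<theta>") auto
  define t where "t = lam \<bullet> \<alpha> + mu \<bullet> \<beta> - r"
  have "0 \<le> v \<bullet> (Y *v v) + 2 * (y \<bullet> v) + t" for v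
    using upper[of v] by (simp add: r t_def)
  then have "psd (bordered Y y t)"
    using assms(2) by (simp add: psd_bordered_iff)
  \<comment> \<open>By the choice of \<open>y\<close> the left side is exactly
    \<open>- z\<close>.\<close>
  moreover have "w + 2 *\<^sub>R y \<le> 0"
    using assms(3) by (simp add: y_def less_eq_vec_def)
  ultimately have "gw_dual_feasible \<alpha> \<beta> L lam mu Z \<eta> \<theta> y t"
    using assms(4,5) Y by (simp add: gw_dual_feasible_iff w_def)
  moreover have "gw_dual_objective \<alpha> \<beta> lam mu t = r"
    by (simp add: gw_dual_objective_def t_def)
  ultimately show ?thesis
    using r by force
qed

text \<open>The first conjunct certifies that the Lagrangian encodes (GW++) and no other problem. In
  the other two, a supremum over an empty feasible set is -\<infinity> in \<open>ereal\<close>, as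
  the convention for infeasible problems demands.\<close>

theorem theorem5p1:
  fixes \<alpha> :: "real ^ 'm" and \<beta> :: "real ^ 'n"
    and C :: "real ^ 'm ^ 'm" and D :: "real ^ 'n ^ 'n"
    and l :: "real \<times> real \<Rightarrow> real"
    and L :: "real ^ ('m \<times> 'n) ^ ('m \<times> 'n)"
  assumes "\<alpha> \<in> prob_simplex" and "\<beta> \<in> prob_simplex"
    and "symmetric C" and "symmetric D"
    and "smooth l"
    and "L = cost_matrix l C D"
  shows
    "(\<forall>\<pi> P. symmetric P \<longrightarrow>
        (SUP (Y, z, lam, mu, Z, \<eta>, \<theta>) \<in> gwpp_multipliers.
           ereal (gwpp_lagrangian \<alpha> \<beta> L Y z lam mu Z \<eta> \<theta> \<pi> P))
        = (if gwpp_feasible \<alpha> \<beta> \<pi> P then ereal (gwpp_objective L P) else \<infinity>)) \<and>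
     (\<forall>lam mu \<eta> \<theta> Z. symmetric Z \<longrightarrow> 0 \<le> Z \<longrightarrow>
        (SUP (Y, z) \<in> {Y. symmetric Y} \<times> {z. 0 \<le> z}. dual_function \<alpha> \<beta> L Y z lam mu Z \<eta> \<theta>)
        = (SUP (y, t) \<in> {(y, t). gw_dual_feasible \<alpha> \<beta> L lam mu Z \<eta> \<theta> y t}.
             ereal (gw_dual_objective \<alpha> \<beta> lam mu t))) \<and>
     (SUP (Y, z, lam, mu, Z, \<eta>, \<theta>) \<in> gwpp_multipliers. dual_function \<alpha> \<beta> L Y z lam mu Z \<eta> \<theta>)
     = (SUP (lam, mu, \<eta>, \<theta>, Z, y, t) \<in>
            {(lam, mu, \<eta>, \<theta>, Z, y, t). gw_dual_feasible \<alpha> \<beta> L lam mu Z \<eta> \<theta> y t}.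
          ereal (gw_dual_objective \<alpha> \<beta> lam mu t))"
proof (intro conjI allI impI)
  have L: "symmetric L"
    using assms by (simp add: symmetric_cost_matrix)
  show "(SUP (Y, z, lam, mu, Z, \<eta>, \<theta>) \<in> gwpp_multipliers.
           ereal (gwpp_lagrangian \<alpha> \<beta> L Y z lam mu Z \<eta> \<theta> \<pi> P))
        = (if gwpp_feasible \<alpha> \<beta> \<pi> P then ereal (gwpp_objective L P) else \<infinity>)"
    if "symmetric P" for \<pi> P
    using SUP_lagrangian_feasible[OF L] SUP_lagrangian_infeasible[OF L that] by auto
  note ge = dual_function_ge_gw_dual_objective[OF L]
  \<comment> \<open>Stated with an arbitrary upper bound \<open>b\<close>, so that it serves both
    the supremum with fixed multipliers and the one over all of them. The value -\<infinity> is
    split off because it provides no feasible \<open>(y, t)\<close>.\<close>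
  have le: "dual_function \<alpha> \<beta> L Y z lam mu Z \<eta> \<theta> \<le> b"
    if "symmetric Y" "0 \<le> z" "symmetric Z" "0 \<le> Z"
      and b: "\<And>y t. gw_dual_feasible \<alpha> \<beta> L lam mu Z \<eta> \<theta> y t \<Longrightarrow>
        ereal (gw_dual_objective \<alpha> \<beta> lam mu t) \<le> b"
    for Y z lam mu Z \<eta> \<theta> b
  proof (cases "dual_function \<alpha> \<beta> L Y z lam mu Z \<eta> \<theta> = -\<infinity>")
    case False
    then show ?thesis
      using dual_function_le_gw_dual_objective[OF L that(1-4)] b order_trans by metis
  qed simp
  show "(SUP (Y, z) \<in> {Y. symmetric Y} \<times> {z. 0 \<le> z}. dual_function \<alpha> \<beta> L Y z lam mu Z \<eta> \<theta>)
        = (SUP (y, t) \<in> {(y, t). gw_dual_feasible \<alpha> \<beta> L lam mu Z \<eta> \<theta> y t}.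
             ereal (gw_dual_objective \<alpha> \<beta> lam mu t))" (is "?D = ?G")
    if Z: "symmetric Z" "0 \<le> Z" for lam mu \<eta> \<theta> Z
  proof (rule antisym)
    show "?D \<le> ?G"
      by (rule SUP_least, clarify, rule le) (use Z in \<open>auto intro: SUP_upper2\<close>)
    show "?G \<le> ?D"
    proof (rule SUP_least, clarify)
      fix y t assume "gw_dual_feasible \<alpha> \<beta> L lam mu Z \<eta> \<theta> y t"
      then obtain Y z where "symmetric Y" "0 \<le> z"
        "ereal (gw_dual_objective \<alpha> \<beta> lam mu t) \<le> dual_function \<alpha> \<beta> L Y z lam mu Z \<eta> \<theta>"
        using ge by blast
      then show "ereal (gw_dual_objective \<alpha> \<beta> lam mu t) \<le> ?D"
        by (intro SUP_upper2[of "(Y, z)"]) auto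
    qed
  qed
  show "(SUP (Y, z, lam, mu, Z, \<eta>, \<theta>) \<in> gwpp_multipliers. dual_function \<alpha> \<beta> L Y z lam mu Z \<eta> \<theta>)
     = (SUP (lam, mu, \<eta>, \<theta>, Z, y, t) \<in>
            {(lam, mu, \<eta>, \<theta>, Z, y, t). gw_dual_feasible \<alpha> \<beta> L lam mu Z \<eta> \<theta> y t}.
          ereal (gw_dual_objective \<alpha> \<beta> lam mu t))" (is "?D = ?G")
  proof (rule antisym)
    show "?D \<le> ?G"
    proof (rule SUP_least, clarify)
      fix Y :: "real ^ ('m \<times> 'n) ^ ('m \<times> 'n)" and z lam mu Z \<eta> \<theta>
      assume "(Y, z, lam, mu, Z, \<eta>, \<theta>) \<in> gwpp_multipliers"
      then have "symmetric Y" "0 \<le> z" "symmetric Z" "0 \<le> Z"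
        by (auto simp: gwpp_multipliers_def)
      then show "dual_function \<alpha> \<beta> L Y z lam mu Z \<eta> \<theta> \<le> ?G"
      proof (rule le)
        fix y t assume "gw_dual_feasible \<alpha> \<beta> L lam mu Z \<eta> \<theta> y t"
        then show "ereal (gw_dual_objective \<alpha> \<beta> lam mu t) \<le> ?G"
          by (intro SUP_upper2[of "(lam, mu, \<eta>, \<theta>, Z, y, t)"]) auto
      qed
    qed
    show "?G \<le> ?D"
    proof (rule SUP_least, clarify)
      fix lam mu \<eta> \<theta> Z y t assume feas: "gw_dual_feasible \<alpha> \<beta> L lam mu Z \<eta> \<theta> y t"
      then obtain Y z where "symmetric Y" "0 \<le> z"
        "ereal (gw_dual_objective \<alpha> \<beta> lam mu t) \<le> dual_function \<alpha> \<beta> L Y z lam mu Z \<eta> \<theta>"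
        using ge by blast
      with feas show "ereal (gw_dual_objective \<alpha> \<beta> lam mu t) \<le> ?D"
        by (intro SUP_upper2[of "(Y, z, lam, mu, Z, \<eta>, \<theta>)"])
          (auto simp: gwpp_multipliers_def gw_dual_feasible_def)
    qed
  qed
qed

end
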